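(* Let $\mathcal{A},\mathcal{B}\subset\mathbb{Z}^d$ be two finite sets of points with $\mathcal{B}\subset\mathrm{Conv}(\mathcal{A})$. The following integer linear programming model allows to compute a mediated graph in $\mathrm{MinMG}_{\mathcal{A}}(\mathcal{B})$: $$\text{minimize } |\mathcal{A}|+|\mathcal{B}|+\sum_{v\in\mathcal{V}\setminus(\mathcal{A}\cup\mathcal{B})}x_v$$ subject to - $y_{vw}\le x_v$ for all $v,w\in\mathcal{V}$; - $y_{vw}\le x_w$ for all $v,w\in\mathcal{V}$; - $y_{v(2v-w)}\ge y_{vw}$ for all $v\ne w$ in $\mathcal{V}$ with $2v-w\in\mathcal{V}$; - $y_{vw}=0$ for all $v\ne w$ in $\mathcal{V}$ with $2v-w\notin\mathcal{V}$; - $\sum_{w\in\mathcal{V}}y_{vw}=2x_v$ for all $v\in\mathcal{V}\setminus\mathcal{A}$; - $x_v=1$ for all $v\in\mathcal{A}\cup\mathcal{B}$; - $x_v\in\{0,1\}$ for all $v\in\mathcal{V}$; - $y_{vw}\in\{0,1\}$ for all $v,w\in\mathcal{V}$; where $\mathcal{V}$ is the (finite) set of potential positions for the mediated vertices. Here $x_v=1$ means that $v$ is a vertex of the computed graph, and $y_{vw}=1$ means that $(v,w)$ is an arc of it.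
   Context: Let $\mathbb{M}\subseteq\mathbb{R}^d$ be a domain and $\mathcal{A}\subset\mathbb{M}$ a finite nonempty set. An $\mathcal{A}$-mediated graph is a digraph $G=(V,E)$ with $\mathcal{A}\subset V\subset\mathbb{M}$, $E\subset V\times V$, such that, writing $\delta^+(v)=\{w\in V:(v,w)\in E\}$, for every $v\in V\setminus\mathcal{A}$: $\delta^+(v)\ne\emptyset$, and $w\in\delta^+(v)$ implies $2v-w\in\delta^+(v)$. Without loss of generality (by deleting superfluous arcs) one takes $|\delta^+(v)|=2$ for all $v\in V\setminus\mathcal{A}$ and $\delta^+(a)=\emptyset$ for all $a\in\mathcal{A}$. $\mathcal{M}_{\mathcal{A}}(\mathcal{B})$ is the set of $\mathcal{A}$-mediated graphs $(V,E)$ (in the domain $\mathbb{M}$) with $\mathcal{B}\subset V$. $\mathrm{MinMG}_{\mathcal{A}}(\mathcal{B})$ is the set of those $(V,E)\in\mathcal{M}_{\mathcal{A}}(\mathcal{B})$ for which there is no $(V',E')\in\mathcal{M}_{\mathcal{A}}(\mathcal{B})$ with $|V'|<|V|$. $\mathrm{Conv}$ denotes the convex hull. The setting is that of a discrete domain: $\mathbb{M}$ is a lattice such as $\mathbb{Z}^d$ or $(2\mathbb{Z})^d$, so that the vertices of mediated graphs are sought in a finite set of points (every $\mathcal{A}$-mediated graph has its vertices in $\mathrm{Conv}(\mathcal{A})\cap\mathbb{M}$). *)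

theory Defs
  imports "HOL-Analysis.Analysis"
begin

definition int_points :: "(real ^ 'n) set" where
  "int_points = {p. \<forall>i. p $ i \<in> \<int>}"

(* A lattice need not have full rank here. *)
definition is_lattice :: "(real ^ 'n) set \<Rightarrow> bool" where
  "is_lattice M \<longleftrightarrow>
     (\<exists>b. independent b \<and> M = {\<Sum>v\<in>b. of_int (k v) *\<^sub>R v | k :: real ^ 'n \<Rightarrow> int. True})"

type_synonym 'a graph = "'a set \<times> ('a \<times> 'a) set"

definition out_nbrs :: "'a graph \<Rightarrow> 'a \<Rightarrow> 'a set" where
  "out_nbrs G v = {w \<in> fst G. (v, w) \<in> snd G}"

definition mediated_graph ::
    "'a::real_vector set \<Rightarrow> 'a set \<Rightarrow> 'a graph \<Rightarrow> bool" where
  "mediated_graph M A G \<longleftrightarrow>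
     finite (fst G) \<and> A \<subseteq> fst G \<and> fst G \<subseteq> M \<and> snd G \<subseteq> fst G \<times> fst G \<and>
     (\<forall>v \<in> fst G - A. out_nbrs G v \<noteq> {} \<and>
        (\<forall>w \<in> out_nbrs G v. 2 *\<^sub>R v - w \<in> out_nbrs G v))"

(* The normalisation of out-degrees outside A.  It cannot be dropped: a vertex whose only
   out-neighbour is itself satisfies the closure condition of mediated_graph trivially, as
   2v - v = v.  Together with that condition, out-degree 2 says that v is the midpoint of its two
   out-neighbours, both different from v. *)
definition two_out :: "'a set \<Rightarrow> 'a graph \<Rightarrow> bool" where
  "two_out A G \<longleftrightarrow> (\<forall>v \<in> fst G - A. card (out_nbrs G v) = 2)"

definition med_graphs :: "'a::real_vector set \<Rightarrow> 'a set \<Rightarrow> 'a set \<Rightarrow> 'a graph set" where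
  "med_graphs M A B = {G. mediated_graph M A G \<and> two_out A G \<and> B \<subseteq> fst G}"

definition MinMG :: "'a::real_vector set \<Rightarrow> 'a set \<Rightarrow> 'a set \<Rightarrow> 'a graph set" where
  "MinMG M A B =
     {G \<in> med_graphs M A B. \<not> (\<exists>G' \<in> med_graphs M A B. card (fst G') < card (fst G))}"

definition ilp_objective ::
    "'a set \<Rightarrow> 'a set \<Rightarrow> 'a set \<Rightarrow> ('a \<Rightarrow> int) \<Rightarrow> int" where
  "ilp_objective \<V> A B x = int (card A) + int (card B) + (\<Sum>v \<in> \<V> - (A \<union> B). x v)"

(* Only the values of x on \<V> and of y on \<V> \<times> \<V> are variables of the programme. *)
definition ilp_feasible ::
    "'a::real_vector set \<Rightarrow> 'a set \<Rightarrow> 'a set \<Rightarrow> ('a \<Rightarrow> int) \<Rightarrow> ('a \<Rightarrow> 'a \<Rightarrow> int) \<Rightarrow> bool" where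
  "ilp_feasible \<V> A B x y \<longleftrightarrow>
     (\<forall>v\<in>\<V>. \<forall>w\<in>\<V>. y v w \<le> x v) \<and>
     (\<forall>v\<in>\<V>. \<forall>w\<in>\<V>. y v w \<le> x w) \<and>
     (\<forall>v\<in>\<V>. \<forall>w\<in>\<V>. v \<noteq> w \<and> 2 *\<^sub>R v - w \<in> \<V> \<longrightarrow> y v (2 *\<^sub>R v - w) \<ge> y v w) \<and>
     (\<forall>v\<in>\<V>. \<forall>w\<in>\<V>. v \<noteq> w \<and> 2 *\<^sub>R v - w \<notin> \<V> \<longrightarrow> y v w = 0) \<and>
     (\<forall>v\<in>\<V> - A. (\<Sum>w\<in>\<V>. y v w) = 2 * x v) \<and>
     (\<forall>v\<in>A \<union> B. x v = 1) \<and>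
     (\<forall>v\<in>\<V>. x v \<in> {0, 1}) \<and>
     (\<forall>v\<in>\<V>. \<forall>w\<in>\<V>. y v w \<in> {0, 1})"

definition ilp_optimal ::
    "'a::real_vector set \<Rightarrow> 'a set \<Rightarrow> 'a set \<Rightarrow> ('a \<Rightarrow> int) \<Rightarrow> ('a \<Rightarrow> 'a \<Rightarrow> int) \<Rightarrow> bool" where
  "ilp_optimal \<V> A B x y \<longleftrightarrow>
     ilp_feasible \<V> A B x y \<and>
     (\<forall>x' y'. ilp_feasible \<V> A B x' y' \<longrightarrow> ilp_objective \<V> A B x \<le> ilp_objective \<V> A B x')"

definition ilp_graph ::
    "'a set \<Rightarrow> ('a \<Rightarrow> int) \<Rightarrow> ('a \<Rightarrow> 'a \<Rightarrow> int) \<Rightarrow> 'a graph" where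
  "ilp_graph \<V> x y = ({v \<in> \<V>. x v = 1}, {(v, w) \<in> \<V> \<times> \<V>. y v w = 1})"

(* The programme leaves arcs that start in A unconstrained up to symmetry; these are superfluous,
   and removing them gives out-degree 0 on A. *)
definition drop_arcs_from :: "'a set \<Rightarrow> 'a graph \<Rightarrow> 'a graph" where
  "drop_arcs_from A G = (fst G, {(v, w) \<in> snd G. v \<notin> A})"

end

(* Feasible points of the programme and A-mediated graphs correspond to each other: a feasible point
   gives the graph on {v. x v = 1} with arcs {(v, w). y v w = 1}, and a mediated graph gives
   indicator functions once its arcs starting in A are deleted.  The objective differs from the
   number of vertices only by the constant |A| + |B| - |A \<union> B|.  The programme only sees points of
   Conv(A), which loses nothing: outside A every vertex is the midpoint of two other vertices, so
   the extreme points of Conv(V) lie in A.  Finiteness of the set of potential positions holds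
   because the lattice coordinates are linear functionals, hence bounded on Conv(A). *)
theory Submission
  imports Defs
begin

lemma finite_lattice_Int_bounded:
  fixes M S :: "(real ^ 'n) set"
  assumes "is_lattice M" "bounded S"
  shows "finite (S \<inter> M)"
proof -
  obtain b where ind: "independent b"
    and M: "M = {\<Sum>v\<in>b. of_int (k v) *\<^sub>R v | k :: real ^ 'n \<Rightarrow> int. True}"
    using assms(1) unfolding is_lattice_def by blast
  have fb: "finite b" using ind by (rule independent_imp_finite)
  \<comment> \<open>The functionals dual to \<open>b\<close>, extended from the span of
    \<open>b\<close> to the whole space: on the lattice, \<open>f v\<close> reads off the
    coefficient of \<open>v\<close>.\<close>
  have "\<exists>f :: real ^ 'n \<Rightarrow> real. linear f \<and> (\<forall>w\<in>b. f w = (if w = v then 1 else 0))" for v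
    using linear_independent_extend[OF ind, of "\<lambda>w. if w = v then 1 else 0"] by blast
  then obtain f :: "real ^ 'n \<Rightarrow> real ^ 'n \<Rightarrow> real" where lin: "\<And>v. linear (f v)"
    and f: "\<And>v w. w \<in> b \<Longrightarrow> f v w = (if w = v then 1 else 0)"
    by metis
  have "\<exists>N :: int. \<forall>p\<in>S. \<bar>f v p\<bar> \<le> N" for v
  proof -
    have "bounded (f v ` S)"
      using assms(2) lin linear_conv_bounded_linear bounded_linear_image by blast
    then obtain c where "\<forall>p\<in>S. \<bar>f v p\<bar> \<le> c" by (auto simp: bounded_iff)
    then have "\<forall>p\<in>S. \<bar>f v p\<bar> \<le> \<lceil>c\<rceil>" by (meson le_of_int_ceiling order_trans)
    then show ?thesis by blast
  qed
  then obtain N :: "real ^ 'n \<Rightarrow> int" where N: "\<And>v p. p \<in> S \<Longrightarrow> \<bar>f v p\<bar> \<le> N v"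
    by metis
  \<comment> \<open>\<open>PiE\<close> fixes the values of the coefficient functions outside
    \<open>b\<close>; without this the box would contain infinitely many functions.\<close>
  have "S \<inter> M \<subseteq> (\<lambda>k. \<Sum>v\<in>b. of_int (k v) *\<^sub>R v) ` (PiE b (\<lambda>v. {- N v..N v}))"
  proof
    fix p assume p: "p \<in> S \<inter> M"
    then obtain k :: "real ^ 'n \<Rightarrow> int" where k: "p = (\<Sum>v\<in>b. of_int (k v) *\<^sub>R v)"
      using M by blast
    have coord: "f v p = of_int (k v)" if "v \<in> b" for v
    proof -
      have "f v p = (\<Sum>w\<in>b. of_int (k w) * f v w)"
        unfolding k by (simp add: linear_sum[OF lin] linear_cmul[OF lin])
      also have "\<dots> = (\<Sum>w\<in>b. if w = v then of_int (k w) else 0)"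
        by (rule sum.cong) (auto simp: f)
      finally show ?thesis using that fb by simp
    qed
    have "k v \<in> {- N v..N v}" if "v \<in> b" for v
    proof -
      have "\<bar>real_of_int (k v)\<bar> \<le> N v" using N[of p v] p coord[OF that] by simp
      then show ?thesis by (simp add: abs_le_iff)
    qed
    then have "restrict k b \<in> PiE b (\<lambda>v. {- N v..N v})" by auto
    moreover have "p = (\<Sum>v\<in>b. of_int (restrict k b v) *\<^sub>R v)" unfolding k by simp
    ultimately show "p \<in> (\<lambda>k. \<Sum>v\<in>b. of_int (k v) *\<^sub>R v) ` (PiE b (\<lambda>v. {- N v..N v}))"
      by blast
  qed
  moreover have "finite (PiE b (\<lambda>v. {- N v..N v}))" using fb by (simp add: finite_PiE)
  ultimately show ?thesis by (meson finite_imageI finite_subset)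
qed

text \<open>A vertex outside \<open>A\<close> lies strictly between two other vertices, so it is not
  extreme in the hull of all vertices. That hull is compact, hence spanned by its extreme points,
  all of which are in \<open>A\<close>.\<close>

lemma mediated_graph_vertices_in_hull:
  fixes M A :: "'a::euclidean_space set"
  assumes "mediated_graph M A G" "two_out A G"
  shows "fst G \<subseteq> convex hull A"
proof -
  let ?C = "convex hull (fst G)"
  have "{x. x extreme_point_of ?C} \<subseteq> A"
  proof
    fix v assume "v \<in> {x. x extreme_point_of ?C}"
    then have ext: "v extreme_point_of ?C" by simp
    then have vV: "v \<in> fst G" by (rule extreme_point_of_convex_hull)
    show "v \<in> A"
    proof (rule ccontr)
      assume "v \<notin> A"
      then have c: "card (out_nbrs G v) = 2"
        and sym: "\<And>w. w \<in> out_nbrs G v \<Longrightarrow> 2 *\<^sub>R v - w \<in> out_nbrs G v"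
        using vV assms unfolding mediated_graph_def two_out_def by auto
      \<comment> \<open>Out-degree 2 guarantees a neighbour other than \<open>v\<close>; a loop is
        its own reflection and gives no open segment around \<open>v\<close>.\<close>
      obtain w where w: "w \<in> out_nbrs G v" "w \<noteq> v"
        using c by (metis card_2_iff insert_iff)
      have "w \<in> ?C" "2 *\<^sub>R v - w \<in> ?C"
        using w(1) sym[OF w(1)] by (auto simp: out_nbrs_def intro: hull_inc)
      moreover have "v = midpoint w (2 *\<^sub>R v - w)" by (simp add: midpoint_def)
      moreover have "w \<noteq> 2 *\<^sub>R v - w"
      proof
        assume "w = 2 *\<^sub>R v - w"
        then have "2 *\<^sub>R w = 2 *\<^sub>R v" by (simp add: scaleR_2 algebra_simps)
        then show False using w(2) by simp
      qed
      ultimately show False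
        using ext unfolding extreme_point_of_def
        by (metis midpoint_in_open_segment)
    qed
  qed
  moreover have "compact ?C"
    using assms(1) by (simp add: mediated_graph_def finite_imp_compact_convex_hull)
  then have "?C = convex hull {x. x extreme_point_of ?C}"
    by (rule Krein_Milman_Minkowski) simp
  ultimately have "?C \<subseteq> convex hull A" by (metis hull_mono)
  then show ?thesis by (meson hull_subset order_trans)
qed

lemma out_nbrs_drop_arcs_from:
  "out_nbrs (drop_arcs_from A G) v = (if v \<in> A then {} else out_nbrs G v)"
  by (auto simp: out_nbrs_def drop_arcs_from_def)

text \<open>The conditions on out-neighbours concern only vertices outside \<open>A\<close>, and
  their arcs are kept.\<close>

lemma drop_arcs_from_med_graphs:
  assumes "G \<in> med_graphs M A B"
  shows "drop_arcs_from A G \<in> med_graphs M A B"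
  using assms
  by (auto simp: med_graphs_def mediated_graph_def two_out_def out_nbrs_drop_arcs_from)
     (auto simp: drop_arcs_from_def)

lemma drop_arcs_from_MinMG:
  assumes "G \<in> MinMG M A B"
  shows "drop_arcs_from A G \<in> MinMG M A B"
  using assms drop_arcs_from_med_graphs[of G M A B]
  by (auto simp: MinMG_def drop_arcs_from_def)

text \<open>The objective counts \<open>A \<inter> B\<close> twice. The correction does not depend
  on \<open>x\<close>, so minimising the objective and minimising the number of vertices
  agree.\<close>

lemma ilp_objective_eq:
  assumes "finite \<V>" "A \<union> B \<subseteq> \<V>" "ilp_feasible \<V> A B x y"
  shows "ilp_objective \<V> A B x =
    int (card (fst (ilp_graph \<V> x y))) + (int (card A) + int (card B) - int (card (A \<union> B)))"
proof -
  have x: "\<forall>v\<in>\<V>. x v \<in> {0, 1}" "\<forall>v\<in>A \<union> B. x v = 1"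
    using assms(3) by (auto simp: ilp_feasible_def)
  have "int (card {v \<in> \<V>. x v = 1}) = (\<Sum>v\<in>\<V>. if x v = 1 then 1 else 0)"
    using assms(1) by (simp flip: sum.inter_filter)
  also have "\<dots> = sum x \<V>"
    using x(1) by (intro sum.cong) auto
  also have "\<dots> = sum x (\<V> - (A \<union> B)) + sum x (A \<union> B)"
    using assms(1,2) by (rule sum.subset_diff[rotated])
  also have "sum x (A \<union> B) = int (card (A \<union> B))"
    using x(2) by simp
  finally show ?thesis by (simp add: ilp_objective_def ilp_graph_def)
qed

text \<open>The inequalities between \<open>y\<close> and \<open>x\<close> put both ends of every
  arc among the chosen vertices, the sum constraint gives out-degree 2, and the reflection
  constraints give closure under \<open>w \<mapsto> 2v - w\<close>.\<close>

lemma ilp_graph_med_graphs: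
  assumes "finite \<V>" "\<V> \<subseteq> M" "A \<union> B \<subseteq> \<V>" "ilp_feasible \<V> A B x y"
  shows "ilp_graph \<V> x y \<in> med_graphs M A B"
proof -
  let ?G = "ilp_graph \<V> x y"
  have le: "\<forall>v\<in>\<V>. \<forall>w\<in>\<V>. y v w \<le> x v" "\<forall>v\<in>\<V>. \<forall>w\<in>\<V>. y v w \<le> x w"
    and sym: "\<forall>v\<in>\<V>. \<forall>w\<in>\<V>. v \<noteq> w \<and> 2 *\<^sub>R v - w \<in> \<V> \<longrightarrow> y v (2 *\<^sub>R v - w) \<ge> y v w"
    and out: "\<forall>v\<in>\<V>. \<forall>w\<in>\<V>. v \<noteq> w \<and> 2 *\<^sub>R v - w \<notin> \<V> \<longrightarrow> y v w = 0"
    and deg: "\<forall>v\<in>\<V> - A. (\<Sum>w\<in>\<V>. y v w) = 2 * x v"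
    and x1: "\<forall>v\<in>A \<union> B. x v = 1"
    and x: "\<forall>v\<in>\<V>. x v \<in> {0, 1}"
    and y: "\<forall>v\<in>\<V>. \<forall>w\<in>\<V>. y v w \<in> {0, 1}"
    using assms(4) unfolding ilp_feasible_def by - (elim conjE, assumption)+
  have arc: "x v = 1 \<and> x w = 1" if "v \<in> \<V>" "w \<in> \<V>" "y v w = 1" for v w
  proof -
    have "1 \<le> x v" "1 \<le> x w" using le that by metis+
    moreover have "x v \<in> {0, 1}" "x w \<in> {0, 1}" using x that by blast+
    ultimately show ?thesis by auto
  qed
  have nbrs: "out_nbrs ?G v = {w \<in> \<V>. y v w = 1}" if "v \<in> \<V>" for v
    using arc that by (auto simp: out_nbrs_def ilp_graph_def)
  have card2: "card (out_nbrs ?G v) = 2" if v: "v \<in> fst ?G - A" for v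
  proof -
    have vV: "v \<in> \<V>" "x v = 1" "v \<notin> A" using v by (auto simp: ilp_graph_def)
    have "int (card {w \<in> \<V>. y v w = 1}) = (\<Sum>w\<in>\<V>. if y v w = 1 then 1 else 0)"
      using assms(1) by (simp flip: sum.inter_filter)
    also have "\<dots> = (\<Sum>w\<in>\<V>. y v w)"
      using y vV(1) by (intro sum.cong) auto
    also have "\<dots> = 2" using deg vV by simp
    finally show ?thesis using nbrs[OF vV(1)] by simp
  qed
  have closed: "2 *\<^sub>R v - w \<in> out_nbrs ?G v" if "v \<in> fst ?G" "w \<in> out_nbrs ?G v" for v w
  \<comment> \<open>The reflection constraints exclude \<open>v = w\<close>, but then the reflected
    point is \<open>w\<close> itself.\<close>
  proof (cases "w = v")
    case True
    then show ?thesis using that by (simp add: scaleR_2)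
  next
    case False
    have v: "v \<in> \<V>" using that by (simp add: ilp_graph_def)
    have w: "w \<in> \<V>" "y v w = 1" using that nbrs[OF v] by auto
    \<comment> \<open>Otherwise the programme would force \<open>y v w = 0\<close>.\<close>
    have u: "2 *\<^sub>R v - w \<in> \<V>" using out v w False by force
    have "y v (2 *\<^sub>R v - w) \<ge> 1" using sym v w False u by force
    then have "y v (2 *\<^sub>R v - w) = 1" using y v u by force
    then show ?thesis using nbrs[OF v] u by simp
  qed
  have "out_nbrs ?G v \<noteq> {}" if "v \<in> fst ?G - A" for v
    using card2[OF that] by auto
  moreover have "finite (fst ?G)" "A \<union> B \<subseteq> fst ?G" "fst ?G \<subseteq> M"
    using assms(1-3) x1 by (auto simp: ilp_graph_def)
  moreover have "snd ?G \<subseteq> fst ?G \<times> fst ?G"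
    using arc by (auto simp: ilp_graph_def)
  ultimately show ?thesis
    using card2 closed by (simp add: med_graphs_def mediated_graph_def two_out_def)
qed

text \<open>Only the vertex set has to be recovered, since the objective does not see the
  arcs.\<close>

lemma med_graph_ilp_feasible:
  assumes "finite \<V>" "fst G \<subseteq> \<V>" "G \<in> med_graphs M A B"
  obtains x y where "ilp_feasible \<V> A B x y" "fst (ilp_graph \<V> x y) = fst G"
proof -
  (* Arcs starting in A are dropped because the programme demands symmetry there as well,
     which a mediated graph does not provide. *)
  define x :: "'a \<Rightarrow> int" where "x v = of_bool (v \<in> fst G)" for v
  define y :: "'a \<Rightarrow> 'a \<Rightarrow> int" where "y v w = of_bool (v \<notin> A \<and> (v, w) \<in> snd G)" for v w
  have sub: "A \<subseteq> fst G" "B \<subseteq> fst G" "snd G \<subseteq> fst G \<times> fst G"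
    and card2: "\<And>v. v \<in> fst G - A \<Longrightarrow> card (out_nbrs G v) = 2"
    and closed: "\<And>v w. v \<in> fst G - A \<Longrightarrow> w \<in> out_nbrs G v \<Longrightarrow> 2 *\<^sub>R v - w \<in> out_nbrs G v"
    using assms(3) by (auto simp: med_graphs_def mediated_graph_def two_out_def)
  have refl: "2 *\<^sub>R v - w \<in> \<V> \<and> (v, 2 *\<^sub>R v - w) \<in> snd G" if "v \<notin> A" "(v, w) \<in> snd G" for v w
    using closed[of v w] that sub assms(2) by (auto simp: out_nbrs_def)
  have "(\<Sum>w\<in>\<V>. y v w) = 2 * x v" if "v \<in> \<V> - A" for v
  proof -
    have "{w \<in> \<V>. (v, w) \<in> snd G} = out_nbrs G v"
      using sub assms(2) by (auto simp: out_nbrs_def)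
    then have "(\<Sum>w\<in>\<V>. y v w) = int (card (out_nbrs G v))"
      using that assms(1) by (simp add: y_def of_bool_def flip: sum.inter_filter)
    also have "\<dots> = 2 * x v"
    proof (cases "v \<in> fst G")
      case True
      then show ?thesis using card2 that by (simp add: x_def)
    next
      \<comment> \<open>A point that is not a vertex has no outgoing arcs, so both sides are
        0.\<close>
      case False
      then have "out_nbrs G v = {}" using sub by (auto simp: out_nbrs_def)
      then show ?thesis using False by (simp add: x_def)
    qed
    finally show ?thesis .
  qed
  then have "ilp_feasible \<V> A B x y"
    unfolding ilp_feasible_def using sub refl by (auto simp: x_def y_def)
  moreover have "fst (ilp_graph \<V> x y) = fst G"
    using assms(2) by (auto simp: ilp_graph_def x_def)
  ultimately show thesis by (rule that)
qed

theorem theorem6: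
  fixes M A B \<V> :: "(real ^ 'n) set"
  assumes "is_lattice M"
    and "finite A" and "A \<noteq> {}" and "A \<subseteq> int_points" and "A \<subseteq> M"
    and "finite B" and "B \<subseteq> int_points" and "B \<subseteq> M"
    and "B \<subseteq> convex hull A"
    and "\<V> = convex hull A \<inter> M"
  shows "finite \<V> \<and>
    ((\<exists>x y. ilp_optimal \<V> A B x y) \<longleftrightarrow> MinMG M A B \<noteq> {}) \<and>
    (\<forall>x y. ilp_optimal \<V> A B x y \<longrightarrow>
       ilp_graph \<V> x y \<in> MinMG M A B \<and>
       drop_arcs_from A (ilp_graph \<V> x y) \<in> MinMG M A B \<and>
       (\<forall>a\<in>A. out_nbrs (drop_arcs_from A (ilp_graph \<V> x y)) a = {}))"
proof -
  have "bounded (convex hull A)"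
    using assms(2) by (simp add: finite_imp_bounded bounded_convex_hull)
  then have fin: "finite \<V>"
    using finite_lattice_Int_bounded assms(1,10) by blast
  have AB: "A \<union> B \<subseteq> \<V>" and VM: "\<V> \<subseteq> M"
    using assms(5,8-10) hull_subset[of A convex] by auto
  note graph = ilp_graph_med_graphs[OF fin VM AB]
  note obj = ilp_objective_eq[OF fin AB]
  \<comment> \<open>Since its vertices lie in the hull of \<open>A\<close>, every competing graph is
    represented in the programme, including those sought anywhere in \<open>M\<close>.\<close>
  have feas: "\<exists>x y. ilp_feasible \<V> A B x y \<and> fst (ilp_graph \<V> x y) = fst G"
    if G: "G \<in> med_graphs M A B" for G
  proof -
    have "fst G \<subseteq> \<V>"
      using G mediated_graph_vertices_in_hull[of M A G] assms(10)
      by (auto simp: med_graphs_def mediated_graph_def)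
    then show ?thesis using med_graph_ilp_feasible[OF fin _ G] by metis
  qed
  have opt: "ilp_graph \<V> x y \<in> MinMG M A B" if o: "ilp_optimal \<V> A B x y" for x y
  proof -
    have f: "ilp_feasible \<V> A B x y" using o by (simp add: ilp_optimal_def)
    have "card (fst (ilp_graph \<V> x y)) \<le> card (fst G)" if G: "G \<in> med_graphs M A B" for G
    proof -
      obtain x' y' where f': "ilp_feasible \<V> A B x' y'" "fst (ilp_graph \<V> x' y') = fst G"
        using feas[OF G] by blast
      then have "ilp_objective \<V> A B x \<le> ilp_objective \<V> A B x'"
        using o by (auto simp: ilp_optimal_def)
      then show ?thesis using obj[OF f] obj[OF f'(1)] f'(2) by simp
    qed
    then show ?thesis using graph[OF f] by (auto simp: MinMG_def not_less)
  qed
  \<comment> \<open>A feasible point with the vertex set of a minimum graph is optimal: any cheaper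
    one would yield a graph with fewer vertices.\<close>
  have "\<exists>x y. ilp_optimal \<V> A B x y" if G: "G \<in> MinMG M A B" for G
  proof -
    obtain x y where f: "ilp_feasible \<V> A B x y" "fst (ilp_graph \<V> x y) = fst G"
      using feas[of G] G by (auto simp: MinMG_def)
    have "ilp_objective \<V> A B x \<le> ilp_objective \<V> A B x'" if f': "ilp_feasible \<V> A B x' y'" for x' y'
    proof -
      have "card (fst G) \<le> card (fst (ilp_graph \<V> x' y'))"
        using G graph[OF f'] by (auto simp: MinMG_def not_less)
      then show ?thesis using obj[OF f(1)] obj[OF f'] f(2) by simp
    qed
    then show ?thesis using f(1) by (auto simp: ilp_optimal_def)
  qed
  then show ?thesis
    using fin opt drop_arcs_from_MinMG[OF opt] by (auto simp: out_nbrs_drop_arcs_from)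
qed

end
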